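(* No solvable percentage test has cost less than $19$. For every integer $C\ge 19$, there exists a monosolvable percentage test of cost $C$.
   Context: A percentage test is a finite nonempty multiset of positive integers (its answers, or options, interpreted as percentages; order is irrelevant). Its cost is the sum of all answers with multiplicity. Let $K$ be the number of options counted with multiplicity, and let $m_a$ be the number of times the value $a$ appears. A value $a$ appearing in the test is a valid answer if $a=\frac{100\,m_a}{K}$. A test is solvable if it has at least one valid answer, and monosolvable if it has exactly one distinct valid answer. *)

theory Defs
  imports Complex_Main "HOL-Library.Multiset"
begin

definition percentage_test :: "nat multiset \<Rightarrow> bool" where
  "percentage_test T \<longleftrightarrow> T \<noteq> {#} \<and> (\<forall>a\<in>#T. a > 0)"

definition cost :: "nat multiset \<Rightarrow> nat" where
  "cost T = sum_mset T"

text \<open>The division is real division, so an answer is valid only if it is the exact percentage.\<close>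

definition valid_answer :: "nat multiset \<Rightarrow> nat \<Rightarrow> bool" where
  "valid_answer T a \<longleftrightarrow> a \<in># T \<and> real a = 100 * real (count T a) / real (size T)"

definition solvable :: "nat multiset \<Rightarrow> bool" where
  "solvable T \<longleftrightarrow> (\<exists>a. valid_answer T a)"

definition monosolvable :: "nat multiset \<Rightarrow> bool" where
  "monosolvable T \<longleftrightarrow> (\<exists>!a. valid_answer T a)"

end

theory Submission
  imports Defs
begin

text \<open>
  Suppose the value \<open>a\<close> appears \<open>m\<close> times among \<open>K\<close> options and is valid, so \<open>a K = 100 m\<close>. The other
  \<open>K - m\<close> options cost at least \<open>1\<close> each, so the cost is at least \<open>a m + K - m = 100 m\<^sup>2 / K + K - m\<close>.
  By the inequality of arithmetic and geometric means \<open>100 m\<^sup>2 / K + K \<ge> 20 m\<close>, and so the cost is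
  at least \<open>19 m \<ge> 19\<close>.

  Equality holds for \<open>m = 1\<close>, \<open>K = 10\<close>, \<open>a = 10\<close> with nine other options equal to \<open>1\<close>. In any test with ten
  options, a value is valid exactly when it is ten times its multiplicity. Raising one of the nine
  ones to \<open>C - 18\<close> therefore gives every cost \<open>C \<ge> 19\<close> and keeps \<open>10\<close> as the only valid answer,
  except that for \<open>C = 28\<close> the raised option is itself \<open>10\<close>, which spoils the count of \<open>10\<close>; there the
  excess is spread over two options instead.
\<close>

lemma cost_ge_size_plus_excess:
  assumes "\<forall>x\<in>#T. x > 0"
  shows "size T + (a - 1) * count T a \<le> cost T"
  using assms by (induction T) (auto simp: cost_def)

lemma valid_answer_iff_nat:
  "valid_answer T a \<longleftrightarrow> a \<in># T \<and> a * size T = 100 * count T a"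
proof (cases "a \<in># T")
  case True
  then have "real (size T) \<noteq> 0"
    by auto
  then have "real a = 100 * real (count T a) / real (size T)
      \<longleftrightarrow> real (a * size T) = real (100 * count T a)"
    by (simp add: nonzero_eq_divide_eq del: of_nat_eq_0_iff)
  then show ?thesis
    using True unfolding valid_answer_def of_nat_eq_iff by simp
qed (simp add: valid_answer_def)

text \<open>The arithmetic-geometric mean step, with denominators cleared: multiply the claim by
  \<open>K\<close> and substitute \<open>a K = 100 m\<close>; what remains is \<open>(10 m - K)\<^sup>2 \<ge> 0\<close>.\<close>

lemma twenty_times_le_of_exact_percentage:
  fixes a m K :: nat
  assumes "a * K = 100 * m" and "K > 0"
  shows "20 * m \<le> a * m + K"
proof -
  have "0 \<le> (10 * int m - int K)\<^sup>2"
    by simp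
  also have "\<dots> = int (100 * m * m + K * K) - int (20 * m * K)"
    by (simp add: power2_eq_square algebra_simps)
  finally have "20 * m * K \<le> 100 * m * m + K * K"
    by linarith
  also have "\<dots> = (a * m + K) * K"
    using assms(1) by (simp add: algebra_simps)
  finally show ?thesis
    using assms(2) by simp
qed

lemma cost_ge_19_times_count_of_valid_answer:
  assumes "percentage_test T" and "valid_answer T a"
  shows "19 * count T a \<le> cost T"
proof -
  have a: "a \<in># T" "a * size T = 100 * count T a"
    using assms(2) by (auto simp: valid_answer_iff_nat)
  have "a > 0" "size T > 0"
    using assms(1) a(1) by (auto simp: percentage_test_def nonempty_has_size)
  then have "20 * count T a \<le> a * count T a + size T"
    using twenty_times_le_of_exact_percentage a(2) by blast
  also have "a * count T a = (a - 1) * count T a + count T a"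
    using \<open>a > 0\<close> by (cases a) auto
  finally show ?thesis
    using cost_ge_size_plus_excess[of T a] assms(1) by (simp add: percentage_test_def)
qed

lemma valid_answer_iff_of_size_10:
  assumes "size T = 10"
  shows "valid_answer T a \<longleftrightarrow> a \<in># T \<and> a = 10 * count T a"
  using assms by (auto simp: valid_answer_iff_nat)

lemma monosolvable_test_of_cost:
  assumes "C \<ge> 19"
  shows "\<exists>T. percentage_test T \<and> monosolvable T \<and> cost T = C"
proof (cases "C = 28")
  case True
  define T :: "nat multiset" where "T = {#10, 9, 2#} + replicate_mset 7 1"
  have "size T = 10"
    by (simp add: T_def)
  then have "valid_answer T b \<longleftrightarrow> b = 10" for b
    by (auto simp: valid_answer_iff_of_size_10 T_def split: if_splits)
  then have "monosolvable T"
    by (simp add: monosolvable_def)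
  moreover have "percentage_test T" "cost T = C"
    using True by (auto simp: T_def percentage_test_def cost_def split: if_splits)
  ultimately show ?thesis
    by blast
next
  case False
  define T :: "nat multiset" where "T = {#10, C - 18#} + replicate_mset 8 1"
  have "size T = 10"
    by (simp add: T_def)
  then have "valid_answer T b \<longleftrightarrow> b = 10" for b
    using False assms by (auto simp: valid_answer_iff_of_size_10 T_def split: if_splits)
  then have "monosolvable T"
    by (simp add: monosolvable_def)
  moreover have "percentage_test T" "cost T = C"
    using assms by (auto simp: T_def percentage_test_def cost_def split: if_splits)
  ultimately show ?thesis
    by blast
qed

theorem theorem15:
  shows "(\<forall>T. percentage_test T \<and> solvable T \<longrightarrow> \<not> cost T < 19) \<and>
    (\<forall>C::nat. C \<ge> 19 \<longrightarrow> (\<exists>T. percentage_test T \<and> monosolvable T \<and> cost T = C))"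
proof (intro conjI allI impI)
  fix T
  assume T: "percentage_test T \<and> solvable T"
  then obtain a where a: "valid_answer T a"
    by (auto simp: solvable_def)
  then have "count T a \<ge> 1"
    by (simp add: valid_answer_def Suc_le_eq)
  then show "\<not> cost T < 19"
    using cost_ge_19_times_count_of_valid_answer[of T a] T a by linarith
qed (rule monosolvable_test_of_cost)

end
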